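(* Fix $i,j\in\{1,\dots,k\}$ and suppose the trimming proportions satisfy $0\le a=a_i=a_j\le 1-b=1-b_i=1-b_j\le1$; write $\overline{b}=1-b$. For $x\in\{i,j\}$ define $$\Delta_x=aH_x(a)+\int_a^{\overline{b}}H_x(v)\,dv+bH_x(\overline{b}).$$ Then $$V_{11}:=\int_a^{\overline{b}}\int_a^{\overline{b}}K(v,w)\,H_j'(v)\,H_i'(w)\,dv\,dw$$ satisfies $$V_{11}=aH_i(a)H_j(a)+bH_i(\overline{b})H_j(\overline{b})+\int_a^{\overline{b}}H_i(v)H_j(v)\,dv-\Delta_i\,\Delta_j.$$
   Context: $F$ is a cumulative distribution function on the real line, with quantile function $F^{-1}(u)=\inf\{x:F(x)\ge u\}$. The $h_r$ are given real functions, and $H_r:=h_r\circ F^{-1}$. The kernel is $K(v,w)=\min\{v,w\}-vw$ for $0\le v,w\le1$. $H_r'$ is the derivative of $H_r$, with $H_r'(u)\,du=dh_r(F^{-1}(u))$. For $r\in\{i,j\}$, $H_r$ is taken to be finite and absolutely continuous on $[a,\overline{b}]$, so that integration by parts is valid. *)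

theory Defs
  imports "HOL-Probability.Probability"
begin

text \<open>
  The quantile function is extended-real valued, because the infimum is \<open>-\<infinity>\<close> at \<open>u = 0\<close> and may
  be \<open>\<infinity>\<close> at \<open>u = 1\<close>.
\<close>

definition quantile :: "(real \<Rightarrow> real) \<Rightarrow> real \<Rightarrow> ereal" where
  "quantile F u = (INF x\<in>{x. u \<le> F x}. ereal x)"

text \<open>
  The composition \<open>H = h \<circ> F\<^sup>-\<^sup>1\<close>. The values \<open>h (-\<infinity>)\<close> and \<open>h \<infinity>\<close> are part of \<open>h\<close>; the projection to
  the reals is only meaningful at points where \<open>h (quantile F u)\<close> is finite.
\<close>

definition H_fun :: "(real \<Rightarrow> real) \<Rightarrow> (ereal \<Rightarrow> ereal) \<Rightarrow> real \<Rightarrow> real" where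
  "H_fun F h u = real_of_ereal (h (quantile F u))"

text \<open>
  The usual \<open>\<epsilon>\<close>-\<open>\<delta>\<close> notion on a compact interval. The set \<open>S\<close> is a finite family of subintervals,
  each given by its pair of endpoints, with pairwise disjoint interiors.
\<close>

definition abs_continuous_on_interval :: "real \<Rightarrow> real \<Rightarrow> (real \<Rightarrow> real) \<Rightarrow> bool" where
  "abs_continuous_on_interval c d f \<longleftrightarrow>
     (\<forall>\<epsilon>>0. \<exists>\<delta>>0. \<forall>S :: (real \<times> real) set.
        finite S \<longrightarrow>
        (\<forall>(x, y)\<in>S. c \<le> x \<and> x \<le> y \<and> y \<le> d) \<longrightarrow>
        pairwise (\<lambda>p q. {fst p<..<snd p} \<inter> {fst q<..<snd q} = {}) S \<longrightarrow>
        (\<Sum>(x, y)\<in>S. y - x) < \<delta> \<longrightarrow>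
        (\<Sum>(x, y)\<in>S. \<bar>f y - f x\<bar>) < \<epsilon>)"

definition K :: "real \<Rightarrow> real \<Rightarrow> real" where
  "K v w = min v w - v * w"

definition Delta :: "real \<Rightarrow> real \<Rightarrow> (real \<Rightarrow> real) \<Rightarrow> real" where
  "Delta a b G = a * G a + (LINT v:{a..1 - b}|lebesgue. G v) + b * G (1 - b)"

text \<open>
  An absolutely continuous function is differentiable almost everywhere, so the (unspecified) values
  of \<^const>\<open>deriv\<close> at points of non-differentiability do not affect the integrals.
\<close>

definition V11 :: "real \<Rightarrow> real \<Rightarrow> (real \<Rightarrow> real) \<Rightarrow> (real \<Rightarrow> real) \<Rightarrow> real" where
  "V11 a b Gi Gj =
     (LINT w:{a..1 - b}|lebesgue. (LINT v:{a..1 - b}|lebesgue. K v w * deriv Gj v * deriv Gi w))"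

end

theory Submission
  imports Defs
begin

text \<open>
  An absolutely continuous \<open>G\<close> on \<open>[c, d]\<close> has bounded variation, and its variation function is again
  absolutely continuous, so \<open>G\<close> is a difference of two monotone absolutely continuous functions. The
  Stieltjes measure of such a function is absolutely continuous, and its Radon-Nikodym density agrees
  with the derivative almost everywhere by Lebesgue's differentiation theorem. Hence \<open>G\<close> is the
  integral of its derivative. Since \<open>min v w = a + \<integral> 1[u \<le> v] 1[u \<le> w] du\<close> over \<open>[a, 1 - b]\<close>, Fubini's
  theorem turns the double integral of \<open>K\<close> into integrals of the tails \<open>H (1 - b) - H u\<close>.
\<close>

subsection \<open>Families of nonoverlapping intervals\<close>

text \<open>For \<open>U\<close> uniform on \<open>[0, 1]\<close>, \<open>Delta a b G\<close> is the
  mean of \<open>G\<close> at \<open>U\<close> clipped to \<open>[a, 1 - b]\<close>. The claim is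
  thus Hoeffding's covariance formula for two clipped variables, and the atoms of mass
  \<open>a\<close> and \<open>b\<close> produce the boundary terms. The obstacle is that absolute
  continuity is an \<epsilon>-\<delta> condition on finite families of intervals, whereas the
  integrals involve \<open>deriv\<close>, which is controlled only almost everywhere. The families
  are therefore treated as objects with operations (monotone images, unions, clipping) on which all
  facts about variation rest. The kernel is then integrated against Borel densities under
  \<open>lborel\<close>, and completeness of Lebesgue measure carries the result back to
  \<open>deriv\<close>. Fubini on the triangle \<open>u \<le> v\<close> takes the place of
  integration by parts, as it needs only integrable densities.\<close>

definition subintervals :: "real \<Rightarrow> real \<Rightarrow> (real \<times> real) set \<Rightarrow> bool" where
  "subintervals c d S \<longleftrightarrow> finite S \<and> (\<forall>(x, y)\<in>S. c \<le> x \<and> x \<le> y \<and> y \<le> d) \<and>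
     pairwise (\<lambda>p q. {fst p<..<snd p} \<inter> {fst q<..<snd q} = {}) S"

definition total_length :: "(real \<times> real) set \<Rightarrow> real" where
  "total_length S = (\<Sum>(x, y)\<in>S. y - x)"

definition var_sum :: "(real \<Rightarrow> real) \<Rightarrow> (real \<times> real) set \<Rightarrow> real" where
  "var_sum f S = (\<Sum>(x, y)\<in>S. \<bar>f y - f x\<bar>)"

lemma abs_continuous_on_interval_iff:
  "abs_continuous_on_interval c d f \<longleftrightarrow>
     (\<forall>\<epsilon>>0. \<exists>\<delta>>0. \<forall>S. subintervals c d S \<longrightarrow> total_length S < \<delta> \<longrightarrow> var_sum f S < \<epsilon>)"
  unfolding abs_continuous_on_interval_def subintervals_def total_length_def var_sum_def
  by (simp only: imp_conjL)

lemma abs_continuous_on_intervalD: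
  assumes "abs_continuous_on_interval c d f" "\<epsilon> > 0"
  obtains \<delta> where "\<delta> > 0"
    "\<And>S. subintervals c d S \<Longrightarrow> total_length S < \<delta> \<Longrightarrow> var_sum f S < \<epsilon>"
  using assms unfolding abs_continuous_on_interval_iff by meson

lemma open_intervals_disjoint_iff:
  fixes x y x' y' :: real
  assumes "x \<le> y" "x' \<le> y'"
  shows "{x<..<y} \<inter> {x'<..<y'} = {} \<longleftrightarrow> y \<le> x' \<or> y' \<le> x \<or> x = y \<or> x' = y'"
proof
  assume *: "{x<..<y} \<inter> {x'<..<y'} = {}"
  show "y \<le> x' \<or> y' \<le> x \<or> x = y \<or> x' = y'"
  proof (rule ccontr)
    assume "\<not> ?thesis"
    hence "max x x' < min y y'" using assms by auto
    then obtain z where "max x x' < z" "z < min y y'" using dense by blast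
    thus False using * by auto
  qed
qed auto

lemma subintervals_mono:
  "subintervals c d S \<Longrightarrow> c' \<le> c \<Longrightarrow> d \<le> d' \<Longrightarrow> subintervals c' d' S"
  unfolding subintervals_def by fastforce

lemma subintervals_single: "x \<le> y \<Longrightarrow> subintervals x y {(x, y)}"
  unfolding subintervals_def by (auto simp: pairwise_def)

text \<open>Turns disjointness of interiors into inequalities between endpoints, a form that
  monotone maps respect. The last two alternatives cover degenerate pairs, whose position is
  unconstrained.\<close>

lemma subintervals_cases:
  assumes "subintervals c d S" "(x, y) \<in> S" "(x', y') \<in> S"
  shows "(x, y) = (x', y') \<or> y \<le> x' \<or> y' \<le> x \<or> x = y \<or> x' = y'"
proof -
  have "x \<le> y" "x' \<le> y'" using assms unfolding subintervals_def by auto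
  moreover have "{x<..<y} \<inter> {x'<..<y'} = {}" if "(x, y) \<noteq> (x', y')"
  proof -
    have "pairwise (\<lambda>p q. {fst p<..<snd p} \<inter> {fst q<..<snd q} = {}) S"
      using assms(1) by (simp add: subintervals_def)
    from pairwiseD[OF this assms(2,3) that] show ?thesis by simp
  qed
  ultimately show ?thesis using open_intervals_disjoint_iff[of x y x' y'] by blast
qed

text \<open>
  Degenerate pairs \<open>(x, x)\<close> are allowed, so that images under monotone maps are again such families.
  A map may also identify several pairs, but then their common image is degenerate; this is why the
  summand \<open>\<phi>\<close> is assumed to vanish on the diagonal here and below.
\<close>

lemma
  assumes S: "subintervals c d S" and m: "mono m"
    and bd: "\<And>x. c \<le> x \<Longrightarrow> x \<le> d \<Longrightarrow> c' \<le> m x \<and> m x \<le> d'"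
  shows subintervals_map: "subintervals c' d' (map_prod m m ` S)"
    and sum_subintervals_map: "(\<And>x. \<phi> (x, x) = 0) \<Longrightarrow>
          sum \<phi> (map_prod m m ` S) = (\<Sum>(x, y)\<in>S. \<phi> (m x, m y) :: real)"
proof -
  have fin: "finite S" using S by (auto simp: subintervals_def)
  have le: "c \<le> x" "x \<le> y" "y \<le> d" if "(x, y) \<in> S" for x y
    using S that by (auto simp: subintervals_def)
  have "{m x<..<m y} \<inter> {m x'<..<m y'} = {}"
    if "(x, y) \<in> S" "(x', y') \<in> S" "(x, y) \<noteq> (x', y')" for x y x' y'
    using subintervals_cases[OF S that(1,2)] that(3) monoD[OF m, of y x'] monoD[OF m, of y' x]
    by auto
  moreover have "c' \<le> m x" "m x \<le> m y" "m y \<le> d'" if "(x, y) \<in> S" for x y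
    using le[OF that] bd[of x] bd[of y] monoD[OF m, of x y] by auto
  ultimately show "subintervals c' d' (map_prod m m ` S)"
    unfolding subintervals_def using fin
    by (intro conjI pairwiseI) (auto, (metis (no_types, lifting) disjoint_iff greaterThanLessThan_iff)+)
  assume \<phi>: "\<And>x. \<phi> (x, x) = 0"
  have "\<phi> (map_prod m m p) = 0"
    if pq: "p \<in> S" "q \<in> S" "p \<noteq> q" "map_prod m m p = map_prod m m q" for p q
  proof -
    obtain x y where p: "p = (x, y)" by (cases p)
    obtain x' y' where q: "q = (x', y')" by (cases q)
    \<comment> \<open>If \<open>y \<le> x'\<close>, then
      \<open>m x \<le> m y \<le> m x' = m x\<close>; the other alternatives collapse in the same
      way.\<close>
    have "m x = m y"
      using subintervals_cases[OF S, of x y x' y'] pq le[of x y] le[of x' y']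
        monoD[OF m, of x y] monoD[OF m, of x' y'] monoD[OF m, of y x'] monoD[OF m, of y' x]
      unfolding p q by auto
    thus ?thesis by (simp add: p \<phi>)
  qed
  hence "sum \<phi> (map_prod m m ` S) = sum (\<phi> \<circ> map_prod m m) S"
    by (intro sum.reindex_nontrivial fin) auto
  also have "\<dots> = (\<Sum>(x, y)\<in>S. \<phi> (m x, m y))"
    by (intro sum.cong) auto
  finally show "sum \<phi> (map_prod m m ` S) = (\<Sum>(x, y)\<in>S. \<phi> (m x, m y))" .
qed

lemma
  assumes S: "subintervals c d S" and T: "subintervals c d T"
    and disj: "\<And>p q. p \<in> S \<Longrightarrow> q \<in> T \<Longrightarrow> {fst p<..<snd p} \<inter> {fst q<..<snd q} = {}"
  shows subintervals_Un: "subintervals c d (S \<union> T)"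
    and sum_subintervals_Un:
      "(\<And>x. \<phi> (x, x) = 0) \<Longrightarrow> sum \<phi> (S \<union> T) = sum \<phi> S + (sum \<phi> T :: real)"
proof -
  have disj': "{fst q<..<snd q} \<inter> {fst p<..<snd p} = {}" if "p \<in> S" "q \<in> T" for p q
    using disj[OF that] by blast
  show "subintervals c d (S \<union> T)"
    unfolding subintervals_def
  proof (intro conjI pairwiseI)
    fix p q assume "p \<in> S \<union> T" "q \<in> S \<union> T" "p \<noteq> q"
    then consider "p \<in> S" "q \<in> S" | "p \<in> S" "q \<in> T" | "p \<in> T" "q \<in> S" | "p \<in> T" "q \<in> T"
      by blast
    thus "{fst p<..<snd p} \<inter> {fst q<..<snd q} = {}"
    proof cases
      case 1 thus ?thesis using S \<open>p \<noteq> q\<close> by (simp add: subintervals_def pairwise_def)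
    next
      case 2 thus ?thesis by (rule disj)
    next
      case 3 thus ?thesis using disj' by simp
    next
      case 4 thus ?thesis using T \<open>p \<noteq> q\<close> by (simp add: subintervals_def pairwise_def)
    qed
  qed (use S T in \<open>auto simp: subintervals_def\<close>)
  assume \<phi>: "\<And>x. \<phi> (x, x) = 0"
  \<comment> \<open>A pair lying in both families has an interior disjoint from itself, hence is
    degenerate and carries no weight.\<close>
  have "\<phi> p = 0" if "p \<in> S \<inter> T" for p
  proof -
    obtain x y where p: "p = (x, y)" by (cases p)
    have "x \<le> y" using that S unfolding p subintervals_def by auto
    moreover have "{x<..<y} = {}" using disj[of p p] that by (simp add: p)
    ultimately have "x = y" by simp
    thus ?thesis by (simp add: p \<phi>)
  qed
  hence "sum \<phi> (S \<inter> T) = 0" by (intro sum.neutral) auto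
  thus "sum \<phi> (S \<union> T) = sum \<phi> S + sum \<phi> T"
    using S T sum.union_inter[of S T \<phi>] by (auto simp: subintervals_def)
qed

lemma total_length_eq_measure:
  assumes "subintervals c d S"
  shows "total_length S = measure lborel (\<Union>p\<in>S. {fst p<..<snd p})"
proof -
  have "measure lborel (\<Union>p\<in>S. {fst p<..<snd p}) = (\<Sum>p\<in>S. measure lborel {fst p<..<snd p})"
    using assms
    by (intro measure_finite_Union) (auto simp: subintervals_def disjoint_family_on_def pairwise_def)
  also have "\<dots> = total_length S"
    unfolding total_length_def using assms by (intro sum.cong) (auto simp: subintervals_def)
  finally show ?thesis ..
qed

lemma total_length_le:
  assumes "subintervals c d S" "c \<le> d"
  shows "total_length S \<le> d - c"
proof -
  have sub: "(\<Union>p\<in>S. {fst p<..<snd p}) \<subseteq> {c..d}"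
    using assms by (fastforce simp: subintervals_def)
  have "measure lborel (\<Union>p\<in>S. {fst p<..<snd p}) \<le> measure lborel {c..d}"
    by (intro measure_mono_fmeasurable sub) (auto intro!: sets.countable_UN' countable_finite fmeasurableI simp: assms(1)[unfolded subintervals_def] assms(2))
  thus ?thesis using total_length_eq_measure[OF assms(1)] assms(2) by simp
qed

text \<open>Clipping endpoints with \<open>min\<close> and \<open>max\<close> sends an interval on
  one side of \<open>m\<close> to itself and to the degenerate pair \<open>(m, m)\<close>. An
  interval containing \<open>m\<close> is cut there, and the triangle inequality gives the
  estimate.\<close>

lemma var_sum_split:
  assumes S: "subintervals c d S" and m: "c \<le> m" "m \<le> d"
  obtains S1 S2 where "subintervals c m S1" "subintervals m d S2"
    "var_sum f S \<le> var_sum f S1 + var_sum f S2"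
proof -
  let ?l = "\<lambda>x. min x m" and ?r = "\<lambda>x. max x m"
  let ?S1 = "map_prod ?l ?l ` S" and ?S2 = "map_prod ?r ?r ` S"
  let ?\<phi> = "\<lambda>(x, y). \<bar>f y - f x\<bar>"
  have l: "mono ?l" and r: "mono ?r" by (auto simp: mono_def)
  have 1: "subintervals c m ?S1"
    by (rule subintervals_map[OF S l]) (use m in auto)
  have 2: "subintervals m d ?S2"
    by (rule subintervals_map[OF S r]) (use m in auto)
  have v1: "var_sum f ?S1 = (\<Sum>(x, y)\<in>S. ?\<phi> (?l x, ?l y))"
    unfolding var_sum_def by (rule sum_subintervals_map[OF S l, where c' = c and d' = m]) (use m in auto)
  have v2: "var_sum f ?S2 = (\<Sum>(x, y)\<in>S. ?\<phi> (?r x, ?r y))"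
    unfolding var_sum_def by (rule sum_subintervals_map[OF S r, where c' = m and d' = d]) (use m in auto)
  have "var_sum f S \<le> (\<Sum>(x, y)\<in>S. ?\<phi> (?l x, ?l y) + ?\<phi> (?r x, ?r y))"
    unfolding var_sum_def
  proof (intro sum_mono, clarify)
    fix x y assume "(x, y) \<in> S"
    hence "x \<le> y" using S by (auto simp: subintervals_def)
    thus "\<bar>f y - f x\<bar> \<le> \<bar>f (?l y) - f (?l x)\<bar> + \<bar>f (?r y) - f (?r x)\<bar>"
      by (cases "y \<le> m"; cases "m \<le> x") (auto simp: min_def max_def)
  qed
  also have "\<dots> = var_sum f ?S1 + var_sum f ?S2"
    unfolding v1 v2 by (simp add: sum.distrib split_beta)
  finally show thesis using that 1 2 by blast
qed

text \<open>Intervals shorter than the \<delta> for \<epsilon> = 1 have variation at most 1, and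
  boundedness passes to the union of adjacent intervals. Bolzano's bisection principle then covers
  all of \<open>[c, d]\<close>.\<close>

lemma abs_continuous_bounded_variation:
  assumes f: "abs_continuous_on_interval c d f" and "c \<le> d"
  shows "\<exists>B. \<forall>S. subintervals c d S \<longrightarrow> var_sum f S \<le> B"
proof -
  obtain \<delta> where \<delta>: "\<delta> > 0"
    "\<And>S. subintervals c d S \<Longrightarrow> total_length S < \<delta> \<Longrightarrow> var_sum f S < 1"
    using abs_continuous_on_intervalD[OF f, of 1] by auto
  \<comment> \<open>The local condition of \<open>Bolzano\<close> also produces intervals that stick
    out of \<open>[c, d]\<close>; the two guards make \<open>P\<close> vacuous there.\<close>
  define P where "P u v \<longleftrightarrow> (c \<le> u \<longrightarrow> v \<le> d \<longrightarrow>
    (\<exists>B. \<forall>S. subintervals u v S \<longrightarrow> var_sum f S \<le> B))" for u v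
  have "P c d"
    using \<open>c \<le> d\<close>
  proof (induct rule: Bolzano)
    case (trans u v w)
    show ?case unfolding P_def
    proof (intro impI)
      assume "c \<le> u" "w \<le> d"
      then obtain B1 B2 where "\<And>S. subintervals u v S \<Longrightarrow> var_sum f S \<le> B1"
        "\<And>S. subintervals v w S \<Longrightarrow> var_sum f S \<le> B2"
        using trans unfolding P_def by (meson order_trans)
      hence "var_sum f S \<le> B1 + B2" if "subintervals u w S" for S
        using var_sum_split[OF that \<open>u \<le> v\<close> \<open>v \<le> w\<close>, of f] by (smt (verit))
      thus "\<exists>B. \<forall>S. subintervals u w S \<longrightarrow> var_sum f S \<le> B" by blast
    qed
  next
    case (local x)
    show ?case
    proof (intro exI[of _ \<delta>] conjI allI impI \<delta>(1))
      fix u v assume uv: "u \<le> x \<and> x \<le> v \<and> v - u < \<delta>"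
      show "P u v" unfolding P_def
      proof (intro impI exI[of _ 1] allI)
        fix S assume "c \<le> u" "v \<le> d" "subintervals u v S"
        thus "var_sum f S \<le> 1"
          using \<delta>(2)[of S] total_length_le[of u v S] uv subintervals_mono[of u v S c d] by simp
      qed
    qed
  qed
  thus ?thesis by (simp add: P_def)
qed

subsection \<open>The variation function\<close>

text \<open>The supremum runs over families with gaps instead of partitions, so that union and
  clipping apply directly. It is meaningful once the sums are bounded, which absolute continuity
  ensures.\<close>

definition variation :: "(real \<Rightarrow> real) \<Rightarrow> real \<Rightarrow> real \<Rightarrow> real" where
  "variation f u v = Sup (var_sum f ` Collect (subintervals u v))"

lemma subintervals_empty [simp]: "subintervals u v {}"
  by (simp add: subintervals_def)

lemma variation_least:
  assumes "\<And>S. subintervals u v S \<Longrightarrow> var_sum f S \<le> B"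
  shows "variation f u v \<le> B"
  unfolding variation_def using assms subintervals_empty by (intro cSup_least) blast+

lemma var_sum_le_variation:
  assumes f: "abs_continuous_on_interval c d f" and le: "c \<le> u" "u \<le> v" "v \<le> d"
    and S: "subintervals u v S"
  shows "var_sum f S \<le> variation f u v"
proof -
  obtain B where "\<And>S. subintervals c d S \<Longrightarrow> var_sum f S \<le> B"
    using abs_continuous_bounded_variation[OF f] le by fastforce
  hence "bdd_above (var_sum f ` Collect (subintervals u v))"
    using subintervals_mono le by (intro bdd_aboveI[of _ B]) blast
  thus ?thesis unfolding variation_def using S by (intro cSup_upper) auto
qed

lemma abs_diff_le_variation:
  assumes "abs_continuous_on_interval c d f" "c \<le> u" "u \<le> v" "v \<le> d"
  shows "\<bar>f v - f u\<bar> \<le> variation f u v"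
  using var_sum_le_variation[OF assms subintervals_single[OF assms(3)]] by (simp add: var_sum_def)

lemma variation_superadditive:
  assumes f: "abs_continuous_on_interval c d f" and le: "c \<le> u" "u \<le> v" "v \<le> w" "w \<le> d"
  shows "variation f u v + variation f v w \<le> variation f u w"
proof -
  have *: "var_sum f S + var_sum f T \<le> variation f u w"
    if S: "subintervals u v S" and T: "subintervals v w T" for S T
  proof -
    have S': "subintervals u w S" and T': "subintervals u w T"
      using subintervals_mono S T le by blast+
    have disj: "{fst p<..<snd p} \<inter> {fst q<..<snd q} = {}" if "p \<in> S" "q \<in> T" for p q
    proof -
      have "snd p \<le> v" "v \<le> fst q" using S T that by (auto simp: subintervals_def)
      thus ?thesis by auto
    qed
    have "var_sum f S + var_sum f T = var_sum f (S \<union> T)"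
      unfolding var_sum_def by (rule sum_subintervals_Un[OF S' T' disj, symmetric]) auto
    also have "\<dots> \<le> variation f u w"
      using le by (intro var_sum_le_variation[OF f] subintervals_Un S' T' disj) auto
    finally show ?thesis .
  qed
  \<comment> \<open>The two suprema are taken one at a time: over \<open>S\<close> for fixed
    \<open>T\<close>, then over \<open>T\<close>.\<close>
  have "variation f u v \<le> variation f u w - var_sum f T" if "subintervals v w T" for T
    using *[OF _ that] by (intro variation_least) (simp add: le_diff_eq)
  hence "variation f v w \<le> variation f u w - variation f u v"
    by (intro variation_least) (simp add: le_diff_eq add.commute)
  thus ?thesis by simp
qed

lemma variation_subadditive:
  assumes f: "abs_continuous_on_interval c d f" and le: "c \<le> u" "u \<le> v" "v \<le> w" "w \<le> d"
  shows "variation f u w \<le> variation f u v + variation f v w"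
proof (rule variation_least)
  fix S assume "subintervals u w S"
  then obtain S1 S2 where "subintervals u v S1" "subintervals v w S2"
    "var_sum f S \<le> var_sum f S1 + var_sum f S2"
    using var_sum_split le by blast
  moreover from this have "var_sum f S1 \<le> variation f u v" "var_sum f S2 \<le> variation f v w"
    using le by (auto intro!: var_sum_le_variation[OF f])
  ultimately show "var_sum f S \<le> variation f u v + variation f v w" by linarith
qed

text \<open>
  Only \<open>B = {}\<close> is of interest. In the induction, the intervals of \<open>A\<close> are replaced one by one by
  arbitrary subdivisions, which are collected in \<open>B\<close>.
\<close>

lemma sum_variation_le:
  assumes f: "abs_continuous_on_interval c d f"
    and AC: "\<And>S. subintervals c d S \<Longrightarrow> total_length S < \<delta> \<Longrightarrow> var_sum f S \<le> \<epsilon>"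
    and "finite A" "subintervals c d A" "subintervals c d B"
    and "\<And>p q. p \<in> A \<Longrightarrow> q \<in> B \<Longrightarrow> {fst p<..<snd p} \<inter> {fst q<..<snd q} = {}"
    and "total_length A + total_length B < \<delta>"
  shows "(\<Sum>(x, y)\<in>A. variation f x y) + var_sum f B \<le> \<epsilon>"
  using assms(3-)
proof (induction A arbitrary: B rule: finite_induct)
  case empty
  thus ?case using AC[of B] by (simp add: total_length_def)
next
  case (insert p A)
  obtain x y where p: "p = (x, y)" by (cases p)
  have xy: "c \<le> x" "x \<le> y" "y \<le> d" using insert.prems(1) by (auto simp: subintervals_def p)
  have A: "subintervals c d A"
    using insert.prems(1) by (auto simp: subintervals_def intro: pairwise_mono)
  \<comment> \<open>Moving a subdivision \<open>T\<close> of \<open>p\<close> from \<open>A\<close>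
    into \<open>B\<close> keeps the interiors disjoint and does not increase the total length, so
    the induction hypothesis applies to \<open>T \<union> B\<close>. The bound is uniform in
    \<open>T\<close>, so a supremum over \<open>T\<close> follows.\<close>
  have "var_sum f T \<le> \<epsilon> - (\<Sum>(x, y)\<in>A. variation f x y) - var_sum f B"
    if T: "subintervals x y T" for T
  proof -
    have T': "subintervals c d T" using subintervals_mono[OF T xy(1,3)] .
    have sub: "{fst t<..<snd t} \<subseteq> {x<..<y}" if "t \<in> T" for t
      using T that by (fastforce simp: subintervals_def)
    have TB: "{fst t<..<snd t} \<inter> {fst q<..<snd q} = {}" if "t \<in> T" "q \<in> B" for t q
      using insert.prems(3)[of p q] sub[OF that(1)] that(2) by (fastforce simp: p)
    have TA: "{fst q<..<snd q} \<inter> {fst t<..<snd t} = {}" if "t \<in> T" "q \<in> A" for t q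
    proof -
      have "q \<noteq> p" using insert.hyps that by auto
      moreover have "pairwise (\<lambda>p q. {fst p<..<snd p} \<inter> {fst q<..<snd q} = {}) (insert p A)"
        using insert.prems(1) by (simp add: subintervals_def)
      ultimately have "{fst q<..<snd q} \<inter> {fst p<..<snd p} = {}"
        using that(2) by (auto dest: pairwiseD[of _ _ q p])
      thus ?thesis using sub[OF that(1)] by (fastforce simp: p)
    qed
    have len: "total_length (T \<union> B) = total_length T + total_length B"
      unfolding total_length_def by (rule sum_subintervals_Un[OF T' insert.prems(2) TB]) auto
    have var: "var_sum f (T \<union> B) = var_sum f T + var_sum f B"
      unfolding var_sum_def by (rule sum_subintervals_Un[OF T' insert.prems(2) TB]) auto
    have "total_length T \<le> y - x" by (rule total_length_le[OF T xy(2)])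
    hence "total_length A + total_length (T \<union> B) < \<delta>"
      using insert.prems(4) insert.hyps unfolding len by (simp add: total_length_def p)
    hence "(\<Sum>(x, y)\<in>A. variation f x y) + var_sum f (T \<union> B) \<le> \<epsilon>"
      using TA insert.prems(3)
      by (intro insert.IH A subintervals_Un[OF T' insert.prems(2) TB]) auto
    thus ?thesis unfolding var by simp
  qed
  hence "variation f x y \<le> \<epsilon> - (\<Sum>(x, y)\<in>A. variation f x y) - var_sum f B"
    by (rule variation_least)
  thus ?case using insert.hyps by (simp add: p)
qed

lemma abs_continuous_variation:
  assumes f: "abs_continuous_on_interval c d f"
  shows "abs_continuous_on_interval c d (variation f c)"
  unfolding abs_continuous_on_interval_iff
proof (intro allI impI)
  fix \<epsilon> :: real assume "\<epsilon> > 0"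
  \<comment> \<open>The factor 1/2 restores the strict inequality that is lost when suprema over
    subdivisions are taken.\<close>
  then obtain \<delta> where \<delta>: "\<delta> > 0"
    "\<And>S. subintervals c d S \<Longrightarrow> total_length S < \<delta> \<Longrightarrow> var_sum f S < \<epsilon> / 2"
    using abs_continuous_on_intervalD[OF f, of "\<epsilon> / 2"] by auto
  have "var_sum (variation f c) S < \<epsilon>" if S: "subintervals c d S" "total_length S < \<delta>" for S
  proof -
    have "var_sum (variation f c) S \<le> (\<Sum>(x, y)\<in>S. variation f x y)"
      unfolding var_sum_def
    proof (intro sum_mono, clarify)
      fix x y assume "(x, y) \<in> S"
      hence "c \<le> x" "x \<le> y" "y \<le> d" using S(1) by (auto simp: subintervals_def)
      thus "\<bar>variation f c y - variation f c x\<bar> \<le> variation f x y"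
        using variation_subadditive[OF f, of c x y] variation_superadditive[OF f, of c x y]
          abs_diff_le_variation[OF f, of x y] by simp
    qed
    also have "\<dots> + var_sum f {} \<le> \<epsilon> / 2"
      using S \<delta> by (intro sum_variation_le[OF f, of \<delta>]) (auto simp: subintervals_def less_imp_le total_length_def)
    finally show ?thesis using \<open>\<epsilon> > 0\<close> by (simp add: var_sum_def)
  qed
  thus "\<exists>\<delta>>0. \<forall>S. subintervals c d S \<longrightarrow> total_length S < \<delta> \<longrightarrow> var_sum (variation f c) S < \<epsilon>"
    using \<delta>(1) by blast
qed

lemma abs_continuous_diff:
  assumes f: "abs_continuous_on_interval c d f" and g: "abs_continuous_on_interval c d g"
  shows "abs_continuous_on_interval c d (\<lambda>x. f x - g x)"
  unfolding abs_continuous_on_interval_iff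
proof (intro allI impI)
  fix \<epsilon> :: real assume "\<epsilon> > 0"
  obtain \<delta>1 where 1: "\<delta>1 > 0"
    "\<And>S. subintervals c d S \<Longrightarrow> total_length S < \<delta>1 \<Longrightarrow> var_sum f S < \<epsilon> / 2"
    using abs_continuous_on_intervalD[OF f, of "\<epsilon> / 2"] \<open>\<epsilon> > 0\<close> by auto
  obtain \<delta>2 where 2: "\<delta>2 > 0"
    "\<And>S. subintervals c d S \<Longrightarrow> total_length S < \<delta>2 \<Longrightarrow> var_sum g S < \<epsilon> / 2"
    using abs_continuous_on_intervalD[OF g, of "\<epsilon> / 2"] \<open>\<epsilon> > 0\<close> by auto
  have "var_sum (\<lambda>x. f x - g x) S < \<epsilon>"
    if S: "subintervals c d S" "total_length S < min \<delta>1 \<delta>2" for S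
  proof -
    have "var_sum (\<lambda>x. f x - g x) S \<le> var_sum f S + var_sum g S"
      unfolding var_sum_def sum.distrib[symmetric] by (intro sum_mono) auto
    thus ?thesis using 1(2)[of S] 2(2)[of S] S by auto
  qed
  thus "\<exists>\<delta>>0. \<forall>S. subintervals c d S \<longrightarrow> total_length S < \<delta> \<longrightarrow> var_sum (\<lambda>x. f x - g x) S < \<epsilon>"
    using 1(1) 2(1) by (intro exI[of _ "min \<delta>1 \<delta>2"]) auto
qed

lemma abs_continuous_Jordan:
  assumes f: "abs_continuous_on_interval c d f"
  obtains p q where "abs_continuous_on_interval c d p" "abs_continuous_on_interval c d q"
    "mono_on {c..d} p" "mono_on {c..d} q" "\<And>x. f x = p x - q x"
proof -
  let ?V = "variation f c"
  \<comment> \<open>This single estimate makes both \<open>?V\<close> and \<open>?V - f\<close>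
    monotone, which is all the decomposition requires.\<close>
  have V: "\<bar>f y - f x\<bar> \<le> ?V y - ?V x" if "c \<le> x" "x \<le> y" "y \<le> d" for x y
    using variation_superadditive[OF f, of c x y] abs_diff_le_variation[OF f, of x y] that by simp
  show thesis
  proof
    show "mono_on {c..d} ?V"
      using V by (intro mono_onI) (smt (verit) atLeastAtMost_iff)
    show "mono_on {c..d} (\<lambda>x. ?V x - f x)"
      using V by (intro mono_onI) (smt (verit) atLeastAtMost_iff)
  qed (simp_all add: f abs_continuous_variation abs_continuous_diff)
qed

subsection \<open>Densities of absolutely continuous functions\<close>

text \<open>Composition with this projection extends a function from \<open>[c, d]\<close> by its
  end values, because \<open>interval_measure\<close> is built from a function on the whole
  line.\<close>

definition clamp_real :: "real \<Rightarrow> real \<Rightarrow> real \<Rightarrow> real" where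
  "clamp_real c d x = max c (min d x)"

lemma mono_clamp_real: "mono (clamp_real c d)"
  by (auto simp: mono_def clamp_real_def)

text \<open>The projection is monotone and 1-Lipschitz, so it maps any family to a family in
  \<open>[c, d]\<close> that is no longer in total. Hence one \<delta> serves all \<open>u\<close>
  and \<open>v\<close>, as needed for families located anywhere on the line.\<close>

lemma abs_continuous_clamp:
  assumes f: "abs_continuous_on_interval c d f" and "c \<le> d"
    and "\<epsilon> > 0"
  shows "\<exists>\<delta>>0. \<forall>u v S. subintervals u v S \<longrightarrow> total_length S < \<delta> \<longrightarrow>
           var_sum (\<lambda>x. f (clamp_real c d x)) S < \<epsilon>"
proof -
  let ?m = "clamp_real c d"
  obtain \<delta> where \<delta>: "\<delta> > 0"
    "\<And>S. subintervals c d S \<Longrightarrow> total_length S < \<delta> \<Longrightarrow> var_sum f S < \<epsilon>"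
    using abs_continuous_on_intervalD[OF f \<open>\<epsilon> > 0\<close>] by auto
  have "var_sum (\<lambda>x. f (?m x)) S < \<epsilon>" if S: "subintervals u v S" "total_length S < \<delta>" for u v S
  proof -
    have bd: "c \<le> ?m x \<and> ?m x \<le> d" for x using \<open>c \<le> d\<close> by (auto simp: clamp_real_def)
    have "total_length (map_prod ?m ?m ` S) = (\<Sum>(x, y)\<in>S. ?m y - ?m x)"
      unfolding total_length_def
      by (subst sum_subintervals_map[OF S(1) mono_clamp_real, where c' = c and d' = d]) (use bd in auto)
    also have "\<dots> \<le> total_length S"
      unfolding total_length_def using S(1)
      by (intro sum_mono) (auto simp: clamp_real_def subintervals_def)
    finally have "var_sum f (map_prod ?m ?m ` S) < \<epsilon>"
      using S(2) bd by (intro \<delta>(2) subintervals_map[OF S(1) mono_clamp_real]) auto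
    also have "var_sum f (map_prod ?m ?m ` S) = var_sum (\<lambda>x. f (?m x)) S"
      unfolding var_sum_def
      by (subst sum_subintervals_map[OF S(1) mono_clamp_real, where c' = c and d' = d]) (use bd in auto)
    finally show ?thesis .
  qed
  thus ?thesis using \<delta>(1) by blast
qed

lemma continuous_clamp_abs_continuous:
  assumes f: "abs_continuous_on_interval c d f" and "c \<le> d"
  shows "continuous_on UNIV (\<lambda>x. f (clamp_real c d x))"
  unfolding continuous_on_iff
proof clarify
  fix x \<epsilon> :: real assume "\<epsilon> > 0"
  then obtain \<delta> where \<delta>: "\<delta> > 0" "\<And>u v S. subintervals u v S \<Longrightarrow> total_length S < \<delta> \<Longrightarrow>
           var_sum (\<lambda>x. f (clamp_real c d x)) S < \<epsilon>"
    using abs_continuous_clamp[OF assms] by meson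
  have "dist (f (clamp_real c d y)) (f (clamp_real c d x)) < \<epsilon>" if "dist y x < \<delta>" for y
    using \<delta>(2)[OF subintervals_single, of x y] \<delta>(2)[OF subintervals_single, of y x] that
    by (cases "x \<le> y") (auto simp: var_sum_def total_length_def dist_real_def)
  thus "\<exists>\<delta>>0. \<forall>y\<in>UNIV. dist y x < \<delta> \<longrightarrow>
          dist (f (clamp_real c d y)) (f (clamp_real c d x)) < \<epsilon>"
    using \<delta>(1) by blast
qed

section \<open>Absolute continuity of the Stieltjes measure\<close>

lemma emeasure_interval_measure_Union_cbox_le:
  fixes G :: "real \<Rightarrow> real"
  assumes mono: "mono G" and cont: "continuous_on UNIV G"
    and AC: "\<And>u v S. subintervals u v S \<Longrightarrow> total_length S < \<delta> \<Longrightarrow> var_sum G S < \<epsilon>"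
    and D: "finite D" "\<And>X. X \<in> D \<Longrightarrow> \<exists>u v. X = cbox u v"
    and len: "emeasure lborel (\<Union>D) < ennreal \<delta>"
  shows "emeasure (interval_measure G) (\<Union>D) \<le> ennreal \<epsilon>"
proof -
  \<comment> \<open>The boxes in \<open>D\<close> may overlap; a division of their union has
    disjoint interiors, so its endpoint pairs form an admissible family.\<close>
  obtain p where p: "p division_of \<Union>D"
    using elementary_unions_intervals[OF D] by blast
  note p_D = division_ofD[OF p]
  have p_Icc: "Inf X \<le> Sup X \<and> X = {Inf X..Sup X}" if X: "X \<in> p" for X
  proof -
    obtain u v where "X = cbox u v" using p_D(4)[OF X] by blast
    moreover have "X \<noteq> {}" by (rule p_D(3)[OF X])
    ultimately show ?thesis by auto
  qed
  define e where "e X = (Inf X, Sup X)" for X :: "real set"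
  have inj: "inj_on e p"
  proof (rule inj_onI)
    fix X Y assume "X \<in> p" "Y \<in> p" "e X = e Y"
    have "X = {Inf X..Sup X}" using p_Icc \<open>X \<in> p\<close> by blast
    also have "\<dots> = {Inf Y..Sup Y}" using \<open>e X = e Y\<close> by (simp add: e_def)
    also have "\<dots> = Y" using p_Icc \<open>Y \<in> p\<close> by blast
    finally show "X = Y" .
  qed
  let ?S = "e ` p"
  obtain u v where uv: "\<Union>p \<subseteq> {u..v}"
    using elementary_bounded[OF p] bounded_subset_cbox_symmetric[of "\<Union>p"] p_D(6)
    by (metis box_real(2))
  have S: "subintervals u v ?S"
    unfolding subintervals_def
  proof (intro conjI pairwiseI)
    show "finite ?S" using p_D(1) by simp
    show "\<forall>(x, y)\<in>?S. u \<le> x \<and> x \<le> y \<and> y \<le> v"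
    proof (clarsimp simp: e_def)
      fix X assume X: "X \<in> p"
      hence "X \<subseteq> {u..v}" using uv by blast
      moreover have "Inf X \<in> X" "Sup X \<in> X"
        using p_Icc[OF X] by (metis atLeastAtMost_iff order_refl)+
      ultimately show "u \<le> Inf X \<and> Inf X \<le> Sup X \<and> Sup X \<le> v"
        using p_Icc[OF X] by (meson atLeastAtMost_iff subsetD)
    qed
    fix P Q assume "P \<in> ?S" "Q \<in> ?S" "P \<noteq> Q"
    then obtain X Y where XY: "X \<in> p" "Y \<in> p" "P = e X" "Q = e Y" "X \<noteq> Y" by auto
    have "interior {Inf X..Sup X} \<inter> interior {Inf Y..Sup Y} = {}"
      using p_D(5)[OF XY(1,2,5)] p_Icc[OF XY(1)] p_Icc[OF XY(2)] by metis
    thus "{fst P<..<snd P} \<inter> {fst Q<..<snd Q} = {}"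
      by (simp only: XY e_def fst_conv snd_conv interior_atLeastAtMost_real)
  qed
  have UD: "\<Union>D = \<Union>p" by (simp add: p_D(6))
  have meas: "\<Union>p \<in> sets borel"
    using p_D(1,4) by (intro borel_closed closed_Union) (metis closed_cbox)+
  have "(\<Union>q\<in>?S. {fst q<..<snd q}) \<subseteq> \<Union>p"
  proof
    fix z assume "z \<in> (\<Union>q\<in>?S. {fst q<..<snd q})"
    then obtain X where "X \<in> p" "z \<in> {Inf X..Sup X}" by (auto simp: e_def)
    thus "z \<in> \<Union>p" using p_Icc by blast
  qed
  hence "emeasure lborel (\<Union>q\<in>?S. {fst q<..<snd q}) \<le> emeasure lborel (\<Union>p)"
    using meas by (intro emeasure_mono) auto
  also have "\<dots> < ennreal \<delta>" using len UD by simp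
  finally have "total_length ?S < \<delta>"
    unfolding total_length_eq_measure[OF S] measure_def
    by (cases "emeasure lborel (\<Union>q\<in>?S. {fst q<..<snd q})") (simp_all add: ennreal_less_iff)
  hence "var_sum G ?S < \<epsilon>" by (rule AC[OF S])
  also have "var_sum G ?S = (\<Sum>X\<in>p. G (Sup X) - G (Inf X))"
    unfolding var_sum_def sum.reindex[OF inj]
    using p_Icc mono by (intro sum.cong) (auto simp: e_def mono_def)
  finally have sum: "(\<Sum>X\<in>p. G (Sup X) - G (Inf X)) < \<epsilon>" .
  \<comment> \<open>Cells of the division may share endpoints, so subadditivity is used here.
    Continuity of \<open>G\<close> then gives each closed cell the measure
    \<open>G (Sup X) - G (Inf X)\<close>.\<close>
  have "emeasure (interval_measure G) (\<Union>p) \<le> (\<Sum>X\<in>p. emeasure (interval_measure G) X)"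
  proof -
    have "id ` p \<subseteq> sets (interval_measure G)"
      using p_D(4) by fastforce
    from emeasure_subadditive_finite[OF p_D(1) this] show ?thesis by simp
  qed
  also have "\<dots> = (\<Sum>X\<in>p. ennreal (G (Sup X) - G (Inf X)))"
  proof (intro sum.cong refl)
    fix X assume "X \<in> p"
    hence X: "Inf X \<le> Sup X" "X = {Inf X..Sup X}" using p_Icc by auto
    have "emeasure (interval_measure G) {Inf X..Sup X} = ennreal (G (Sup X) - G (Inf X))"
      using mono cont X(1) by (intro emeasure_interval_measure_Icc) (auto simp: mono_def)
    thus "emeasure (interval_measure G) X = ennreal (G (Sup X) - G (Inf X))"
      using X(2) by simp
  qed
  also have "\<dots> = ennreal (\<Sum>X\<in>p. G (Sup X) - G (Inf X))"
    using p_Icc mono by (intro sum_ennreal) (auto simp: mono_def)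
  also have "\<dots> \<le> ennreal \<epsilon>" using sum by (intro ennreal_leI) simp
  finally show ?thesis unfolding UD .
qed

text \<open>Outer regularity places a null set inside an open set of length below \<delta>. Its
  finite unions of boxes have Stieltjes measure at most \<epsilon>, and continuity from below
  extends this bound to the whole open set.\<close>

lemma absolutely_continuous_interval_measure:
  fixes G :: "real \<Rightarrow> real"
  assumes mono: "mono G" and cont: "continuous_on UNIV G"
    and AC: "\<And>\<epsilon>. \<epsilon> > 0 \<Longrightarrow> \<exists>\<delta>>0. \<forall>u v S. subintervals u v S \<longrightarrow> total_length S < \<delta> \<longrightarrow>
           var_sum G S < \<epsilon>"
  shows "absolutely_continuous lborel (interval_measure G)"
  unfolding absolutely_continuous_def
proof
  let ?\<mu> = "interval_measure G"
  fix A :: "real set" assume "A \<in> null_sets lborel"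
  hence A: "A \<in> sets borel" "emeasure lborel A = 0" by auto
  have small: "emeasure ?\<mu> A \<le> 0 + ennreal \<epsilon>" if "\<epsilon> > 0" for \<epsilon>
  proof -
    obtain \<delta> where \<delta>: "\<delta> > 0" "\<And>u v S. subintervals u v S \<Longrightarrow> total_length S < \<delta> \<Longrightarrow> var_sum G S < \<epsilon>"
      using AC[OF \<open>\<epsilon> > 0\<close>] by meson
    obtain U where U: "open U" "A \<subseteq> U" "emeasure lborel (U - A) < ennreal \<delta>"
      using outer_regular_lborel[OF A(1) \<delta>(1)] by blast
    have "emeasure lborel U < ennreal \<delta>"
      using U A emeasure_Diff_null_set[of A lborel U] by (auto simp: null_sets_def)
    moreover obtain D where D: "countable D" "\<And>X. X \<in> D \<Longrightarrow> \<exists>u v. X = cbox u v" "\<Union>D = U"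
      using open_countable_Union_open_cbox[OF U(1)] by metis
    ultimately have finD: "emeasure ?\<mu> (\<Union>E) \<le> ennreal \<epsilon>" if "finite E" "E \<subseteq> D" for E
    proof -
      have "emeasure lborel (\<Union>E) \<le> emeasure lborel U"
        using that D U by (intro emeasure_mono) auto
      thus ?thesis
        using that D \<delta>(2) \<open>emeasure lborel U < ennreal \<delta>\<close>
        by (intro emeasure_interval_measure_Union_cbox_le[OF mono cont, of \<delta>]) (auto intro: order_le_less_trans)
    qed
    have "emeasure ?\<mu> U \<le> ennreal \<epsilon>"
    proof (cases "D = {}")
      case True thus ?thesis using D by auto
    next
      case False
      define X where "X n = \<Union>(from_nat_into D ` {..<n})" for n
      have "(\<Union>n. X n) = \<Union>(range (from_nat_into D))" by (auto simp: X_def)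
      hence "(\<Union>n. X n) = U" using D(1,3) False by (simp add: range_from_nat_into)
      moreover have "range X \<subseteq> sets ?\<mu>"
      proof -
        have "from_nat_into D i \<in> sets borel" for i
          using D(2)[OF from_nat_into[OF False, of i]] by auto
        thus ?thesis by (auto simp: X_def)
      qed
      moreover have "incseq X" by (rule incseq_SucI) (auto simp: X_def lessThan_Suc)
      ultimately have "(SUP n. emeasure ?\<mu> (X n)) = emeasure ?\<mu> U"
        using SUP_emeasure_incseq[of X ?\<mu>] by simp
      moreover have "(SUP n. emeasure ?\<mu> (X n)) \<le> ennreal \<epsilon>"
        unfolding X_def using from_nat_into[OF False] by (intro SUP_least finD) auto
      ultimately show ?thesis by simp
    qed
    moreover have "emeasure ?\<mu> A \<le> emeasure ?\<mu> U"
      using U by (intro emeasure_mono) auto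
    ultimately show ?thesis by (metis add_0 order_trans)
  qed
  have "emeasure ?\<mu> A \<le> 0" by (rule ennreal_le_epsilon) (rule small)
  thus "A \<in> null_sets ?\<mu>" using A by (auto simp: null_sets_def)
qed

section \<open>Densities with respect to Lebesgue measure\<close>

lemma mono_abs_continuous_density:
  assumes f: "abs_continuous_on_interval c d f" and mono: "mono_on {c..d} f" and "c \<le> d"
  obtains g where "g \<in> borel_measurable borel" "set_integrable lborel {c..d} g"
    "\<forall>x\<in>{c..d}. f x - f c = (LINT t:{c..x}|lborel. g t)"
proof -
  define G where "G x = f (clamp_real c d x)" for x
  have monoG: "mono G"
    unfolding G_def mono_def using \<open>c \<le> d\<close> monoD[OF mono_clamp_real]
    by (auto intro!: mono_onD[OF mono] simp: clamp_real_def)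
  have contG: "continuous_on UNIV G"
    unfolding G_def by (rule continuous_clamp_abs_continuous[OF f \<open>c \<le> d\<close>])
  have "absolutely_continuous lborel (interval_measure G)"
    using abs_continuous_clamp[OF f \<open>c \<le> d\<close>]
    unfolding G_def[abs_def, symmetric]
    by (intro absolutely_continuous_interval_measure monoG contG)
  then obtain \<phi> where \<phi>: "\<phi> \<in> borel_measurable lborel" "density lborel \<phi> = interval_measure G"
    using sigma_finite_measure.Radon_Nikodym[OF sigma_finite_lborel] by fastforce
  have \<phi>_Icc: "(\<integral>\<^sup>+t. \<phi> t * indicator {c..x} t \<partial>lborel) = ennreal (f x - f c)"
    if "c \<le> x" "x \<le> d" for x
  proof -
    have "(\<integral>\<^sup>+t. \<phi> t * indicator {c..x} t \<partial>lborel) = emeasure (interval_measure G) {c..x}"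
      using \<phi>(1) by (simp flip: \<phi>(2) add: emeasure_density)
    also have "\<dots> = ennreal (G x - G c)"
      using that monoG contG by (intro emeasure_interval_measure_Icc) (auto simp: mono_def)
    also have "G x - G c = f x - f c"
      using that by (simp add: G_def clamp_real_def min_def max_def)
    finally show ?thesis .
  qed
  define g where "g t = enn2real (\<phi> t)" for t
  have g[measurable]: "g \<in> borel_measurable borel"
    using borel_measurable_enn2real[OF \<phi>(1)] by (simp add: g_def[abs_def])
  \<comment> \<open>The Radon-Nikodym density takes extended values. Finite mass on
    \<open>[c, d]\<close> makes it finite almost everywhere there, so passing to \<open>g\<close> by
    \<open>enn2real\<close> preserves the integrals.\<close>
  have "AE t in lborel. \<phi> t * indicator {c..d} t \<noteq> \<infinity>"
    using \<phi>(1) \<phi>_Icc[of d] \<open>c \<le> d\<close> by (intro nn_integral_noteq_infinite) auto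
  hence g_Icc: "(\<integral>\<^sup>+t. ennreal (indicator {c..x} t *\<^sub>R g t) \<partial>lborel) = ennreal (f x - f c)"
    if "c \<le> x" "x \<le> d" for x
    unfolding \<phi>_Icc[OF that, symmetric]
  proof (intro nn_integral_cong_AE, eventually_elim)
    case (elim t)
    thus ?case using that by (cases "t \<in> {c..x}") (simp_all add: g_def less_top)
  qed
  have g_nonneg: "0 \<le> g t" for t by (simp add: g_def)
  have fin: "set_integrable lborel {c..x} g" if "c \<le> x" "x \<le> d" for x
    unfolding set_integrable_def using g_Icc[OF that] g_nonneg
    by (intro integrableI_nonneg) auto
  show thesis
  proof
    show "g \<in> borel_measurable borel" by fact
    show "set_integrable lborel {c..d} g" using fin \<open>c \<le> d\<close> by simp
    show "\<forall>x\<in>{c..d}. f x - f c = (LINT t:{c..x}|lborel. g t)"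
    proof
      fix x assume "x \<in> {c..d}"
      hence x: "c \<le> x" "x \<le> d" by auto
      have "0 \<le> f x - f c" using mono_onD[OF mono, of c x] x by simp
      thus "f x - f c = (LINT t:{c..x}|lborel. g t)"
        unfolding set_lebesgue_integral_def using g_Icc[OF x] g_nonneg
        by (subst integral_eq_nn_integral) auto
    qed
  qed
qed

lemma abs_continuous_density:
  assumes f: "abs_continuous_on_interval c d f" and "c \<le> d"
  obtains g where "g \<in> borel_measurable borel" "set_integrable lborel {c..d} g"
    "\<forall>x\<in>{c..d}. f x - f c = (LINT t:{c..x}|lborel. g t)"
proof -
  obtain p q where pq: "abs_continuous_on_interval c d p" "abs_continuous_on_interval c d q"
    "mono_on {c..d} p" "mono_on {c..d} q" "\<And>x. f x = p x - q x"
    using abs_continuous_Jordan[OF f] by blast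
  obtain g where g: "g \<in> borel_measurable borel" "set_integrable lborel {c..d} g"
    "\<forall>x\<in>{c..d}. p x - p c = (LINT t:{c..x}|lborel. g t)"
    using mono_abs_continuous_density[OF pq(1,3) \<open>c \<le> d\<close>] by blast
  obtain h where h: "h \<in> borel_measurable borel" "set_integrable lborel {c..d} h"
    "\<forall>x\<in>{c..d}. q x - q c = (LINT t:{c..x}|lborel. h t)"
    using mono_abs_continuous_density[OF pq(2,4) \<open>c \<le> d\<close>] by blast
  show thesis
  proof
    show "(\<lambda>t. g t - h t) \<in> borel_measurable borel" using g h by simp
    show "set_integrable lborel {c..d} (\<lambda>t. g t - h t)" using g h by (intro set_integral_diff)
    show "\<forall>x\<in>{c..d}. f x - f c = (LINT t:{c..x}|lborel. g t - h t)"
    proof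
      fix x assume x: "x \<in> {c..d}"
      have "set_integrable lborel {c..x} g" "set_integrable lborel {c..x} h"
        using x by (auto intro: set_integrable_subset[OF g(2)] set_integrable_subset[OF h(2)])
      thus "f x - f c = (LINT t:{c..x}|lborel. g t - h t)"
        using bspec[OF g(3) x] bspec[OF h(3) x] by (simp add: set_integral_diff pq(5))
    qed
  qed
qed

subsection \<open>The fundamental theorem of calculus\<close>

text \<open>The differentiation theorem used here averages over boxes with lower corner
  \<open>x\<close>, which yields only the right-hand limit.\<close>

lemma AE_right_derivative_integral:
  fixes f :: "real \<Rightarrow> real"
  assumes "integrable lborel f"
  shows "AE x in lebesgue. ((\<lambda>h. integral {x..x + h} f / h) \<longlongrightarrow> f x) (at_right 0)"
proof -
  have "f integrable_on cbox u v" for u v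
    using integrable_on_lborel[OF assms] integrable_on_subcbox by blast
  from integrable_ccontinuous_explicit[OF this]
  obtain N where N: "negligible N" "\<And>x e. \<lbrakk>x \<notin> N; 0 < e\<rbrakk> \<Longrightarrow>
      \<exists>d>0. \<forall>h. 0 < h \<and> h < d \<longrightarrow> \<bar>integral {x..x + h} f / h - f x\<bar> < e"
    by (auto simp: divide_inverse mult.commute)
  have "((\<lambda>h. integral {x..x + h} f / h) \<longlongrightarrow> f x) (at_right 0)" if "x \<notin> N" for x
    using N(2)[OF that] unfolding tendsto_iff eventually_at_right_field dist_real_def
    by blast
  thus ?thesis
    using N(1) by (intro AE_I'[of N]) (auto simp: negligible_iff_null_sets)
qed

text \<open>Reflection reduces this to the right-hand limit of \<open>f (- t)\<close> at
  \<open>- x\<close>; the reflected exceptional set is still null because \<open>uminus\<close> is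
  differentiable.\<close>

lemma AE_left_derivative_integral:
  fixes f :: "real \<Rightarrow> real"
  assumes f: "integrable lborel f"
  shows "AE x in lebesgue. ((\<lambda>h. integral {x - h..x} f / h) \<longlongrightarrow> f x) (at_right 0)"
proof -
  have "integrable lborel (\<lambda>t. f (- t))"
    using lborel_integrable_real_affine[OF f, of "-1" 0] by simp
  from AE_right_derivative_integral[OF this] obtain N where N: "N \<in> null_sets lebesgue"
    "\<And>y. y \<notin> N \<Longrightarrow> ((\<lambda>h. integral {y..y + h} (\<lambda>t. f (- t)) / h) \<longlongrightarrow> f (- y)) (at_right 0)"
    by (rule AE_E3) auto
  have lim: "((\<lambda>h. integral {x - h..x} f / h) \<longlongrightarrow> f x) (at_right 0)" if "- x \<notin> N" for x
  proof -
    have "integral {- x..- x + h} (\<lambda>t. f (- t)) = integral {x - h..x} f" for h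
      using Henstock_Kurzweil_Integration.integral_reflect_real[of x "x - h" f] by (simp add: add.commute)
    thus ?thesis using N(2)[OF that] by simp
  qed
  show ?thesis
  proof (rule AE_I')
    have "(uminus :: real \<Rightarrow> real) differentiable_on N"
      by (intro linear_imp_differentiable_on linear_uminus)
    thus "uminus ` N \<in> null_sets lebesgue"
      using N(1) unfolding negligible_iff_null_sets[symmetric]
      by (intro negligible_differentiable_image_negligible) auto
    show "{x \<in> space lebesgue. \<not> ((\<lambda>h. integral {x - h..x} f / h) \<longlongrightarrow> f x) (at_right 0)}
            \<subseteq> uminus ` N"
      using lim by (metis (mono_tags, lifting) imageI mem_Collect_eq minus_minus subsetI)
  qed
qed

lemma AE_deriv_eq_density:
  fixes g :: "real \<Rightarrow> real"
  assumes g: "set_integrable lborel {c..d} g"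
    and G: "\<forall>x\<in>{c..d}. G x - G c = (LINT t:{c..x}|lborel. g t)"
  shows "AE x in lebesgue. x \<in> {c..d} \<longrightarrow> deriv G x = g x"
proof -
  define f where "f t = indicator {c..d} t *\<^sub>R g t" for t
  have f: "integrable lborel f" using g by (simp add: f_def[abs_def] set_integrable_def)
  have G_f: "G y - G x = integral {x..y} f" if xy: "c \<le> x" "x \<le> y" "y \<le> d" for x y
  proof -
    have *: "G z - G c = integral {c..z} f" if "c \<le> z" "z \<le> d" for z
    proof -
      have "set_integrable lborel {c..z} g"
        using that by (intro set_integrable_subset[OF g]) auto
      hence "(LINT t:{c..z}|lborel. g t) = integral {c..z} g"
        by (rule set_borel_integral_eq_integral)
      also have "\<dots> = integral {c..z} f"
        using that by (intro integral_cong) (auto simp: f_def)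
      finally show ?thesis using G that by simp
    qed
    have "integral {c..x} f + integral {x..y} f = integral {c..y} f"
      using xy integrable_on_lborel[OF f]
      by (intro Henstock_Kurzweil_Integration.integral_combine) (auto intro: integrable_on_subinterval)
    thus ?thesis using *[of x] *[of y] xy by simp
  qed
  \<comment> \<open>At the endpoints the two-sided derivative depends on values of \<open>G\<close>
    outside \<open>[c, d]\<close>, so they are discarded as a null set.\<close>
  have "AE x in lebesgue. x \<noteq> c \<and> x \<noteq> d"
    by (intro AE_I'[of "{c, d}"]) (auto simp flip: negligible_iff_null_sets)
  thus ?thesis
    using AE_right_derivative_integral[OF f] AE_left_derivative_integral[OF f]
  proof eventually_elim
    case (elim x)
    show ?case
    proof
      assume "x \<in> {c..d}"
      hence x: "c < x" "x < d" using elim by auto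
      have "((\<lambda>h. (G (x + h) - G x) / h) \<longlongrightarrow> f x) (at_right 0)"
      proof (rule Lim_transform_eventually[OF elim(2)])
        show "\<forall>\<^sub>F h in at_right 0. integral {x..x + h} f / h = (G (x + h) - G x) / h"
          unfolding eventually_at_right_field
          using x G_f by (intro exI[of _ "d - x"]) auto
      qed
      moreover have "((\<lambda>h. (G (x + h) - G x) / h) \<longlongrightarrow> f x) (at_left 0)"
        unfolding filterlim_at_left_to_right minus_zero
      proof (rule Lim_transform_eventually[OF elim(3)])
        have "integral {x - h..x} f / h = (G (x + - h) - G x) / (- h)" if "0 < h" "h < x - c" for h
          using G_f[of "x - h" x] x that by (simp add: field_simps)
        thus "\<forall>\<^sub>F h in at_right 0. integral {x - h..x} f / h = (G (x + - h) - G x) / - h"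
          unfolding eventually_at_right_field using x by (intro exI[of _ "x - c"]) auto
      qed
      ultimately have "DERIV G x :> f x"
        unfolding DERIV_def by (simp add: filterlim_split_at)
      thus "deriv G x = g x" using x by (simp add: DERIV_imp_deriv f_def)
    qed
  qed
qed

theorem abs_continuous_fundamental_theorem:
  assumes "abs_continuous_on_interval c d G" and "c \<le> d"
  obtains g where "g \<in> borel_measurable borel" "set_integrable lborel {c..d} g"
    "AE x in lebesgue. x \<in> {c..d} \<longrightarrow> deriv G x = g x"
    "\<forall>x\<in>{c..d}. G x - G c = (LINT t:{c..x}|lborel. g t)"
proof -
  obtain g where g: "g \<in> borel_measurable borel" "set_integrable lborel {c..d} g"
    "\<forall>x\<in>{c..d}. G x - G c = (LINT t:{c..x}|lborel. g t)"
    by (rule abs_continuous_density[OF assms])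
  show thesis
    by (rule that[OF g(1,2) AE_deriv_eq_density[OF g(2,3)] g(3)])
qed

subsection \<open>Integrals against the covariance kernel\<close>

text \<open>The product \<open>g u * f v\<close> is integrable on the plane, and restricting it to
  the triangle \<open>u \<le> v\<close> preserves this. The two sides of the swap are the two
  iterated integrals over that triangle.\<close>

lemma
  fixes f g :: "real \<Rightarrow> real"
  assumes f: "integrable lborel f" and g: "integrable lborel g"
  shows integrable_triangle: "integrable lborel (\<lambda>v. f v * (LINT u|lborel. indicator {..v} u * g u))"
    and integral_triangle_swap: "(LINT v|lborel. f v * (LINT u|lborel. indicator {..v} u * g u)) =
      (LINT u|lborel. g u * (LINT v|lborel. indicator {u..} v * f v))"
proof -
  have [measurable]: "f \<in> borel_measurable borel" "g \<in> borel_measurable borel"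
    using f g by (auto dest: borel_measurable_integrable)
  have "integrable (lborel \<Otimes>\<^sub>M lborel) (\<lambda>(u, v). g u * f v)"
    using f g by (intro lborel_pair.Fubini_integrable) (auto simp: abs_mult)
  hence F: "integrable (lborel \<Otimes>\<^sub>M lborel) (\<lambda>(u, v). indicator {..v} u * (g u * f v))"
    by (rule Bochner_Integration.integrable_bound) (auto simp: indicator_def)
  have snd: "(LINT u|lborel. indicator {..v} u * (g u * f v)) =
      f v * (LINT u|lborel. indicator {..v} u * g u)" for v
    by (simp flip: integral_mult_right_zero add: algebra_simps)
  have fst: "(LINT v|lborel. indicator {..v} u * (g u * f v)) =
      g u * (LINT v|lborel. indicator {u..} v * f v)" for u
    unfolding integral_mult_right_zero[symmetric]
    by (intro Bochner_Integration.integral_cong) (auto simp: indicator_def)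
  show "integrable lborel (\<lambda>v. f v * (LINT u|lborel. indicator {..v} u * g u))"
    using lborel_pair.integrable_snd[OF F] by (simp add: snd)
  show "(LINT v|lborel. f v * (LINT u|lborel. indicator {..v} u * g u)) =
      (LINT u|lborel. g u * (LINT v|lborel. indicator {u..} v * f v))"
    using lborel_pair.Fubini_integral[OF F] by (simp add: fst snd)
qed

lemma
  fixes f g :: "real \<Rightarrow> real"
  assumes f: "set_integrable lborel {c..d} f" and g: "set_integrable lborel {c..d} g"
  shows set_integrable_triangle:
      "set_integrable lborel {c..d} (\<lambda>v. f v * (LINT u:{c..v}|lborel. g u))"
    and set_integral_triangle_swap: "(LINT v:{c..d}|lborel. f v * (LINT u:{c..v}|lborel. g u)) =
      (LINT u:{c..d}|lborel. g u * (LINT v:{u..d}|lborel. f v))"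
proof -
  let ?f = "\<lambda>v. indicator {c..d} v * f v" and ?g = "\<lambda>v. indicator {c..d} v * g v"
  have f': "integrable lborel ?f" and g': "integrable lborel ?g"
    using f g by (simp_all add: set_integrable_def)
  have 1: "indicator {c..d} v *\<^sub>R (f v * (LINT u:{c..v}|lborel. g u)) =
      ?f v * (LINT u|lborel. indicator {..v} u * ?g u)" for v
    by (cases "v \<in> {c..d}")
      (auto simp: set_lebesgue_integral_def indicator_def intro!: Bochner_Integration.integral_cong)
  have 2: "indicator {c..d} u *\<^sub>R (g u * (LINT v:{u..d}|lborel. f v)) =
      ?g u * (LINT v|lborel. indicator {u..} v * ?f v)" for u
    by (cases "u \<in> {c..d}")
      (auto simp: set_lebesgue_integral_def indicator_def intro!: Bochner_Integration.integral_cong)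
  show "set_integrable lborel {c..d} (\<lambda>v. f v * (LINT u:{c..v}|lborel. g u))"
    unfolding set_integrable_def 1 by (rule integrable_triangle[OF f' g'])
  show "(LINT v:{c..d}|lborel. f v * (LINT u:{c..v}|lborel. g u)) =
      (LINT u:{c..d}|lborel. g u * (LINT v:{u..d}|lborel. f v))"
    unfolding set_lebesgue_integral_def[of lborel "{c..d}"] 1 2 by (rule integral_triangle_swap[OF f' g'])
qed

lemma set_integral_tail:
  fixes \<phi> G :: "real \<Rightarrow> real"
  assumes \<phi>: "set_integrable lborel {c..d} \<phi>"
    and G: "\<forall>x\<in>{c..d}. G x - G c = (LINT t:{c..x}|lborel. \<phi> t)" and u: "u \<in> {c..d}"
  shows "(LINT v:{u..d}|lborel. \<phi> v) = G d - G u"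
proof -
  have sub: "set_integrable lborel {x..y} \<phi>" if "c \<le> x" "y \<le> d" for x y
    using that by (intro set_integrable_subset[OF \<phi>]) auto
  have eq: "(LINT t:{x..y}|lborel. \<phi> t) = integral {x..y} \<phi>" if "c \<le> x" "y \<le> d" for x y
    by (rule set_borel_integral_eq_integral(2)[OF sub[OF that]])
  have "integral {c..u} \<phi> + integral {u..d} \<phi> = integral {c..d} \<phi>"
    using u set_borel_integral_eq_integral(1)[OF \<phi>]
    by (intro Henstock_Kurzweil_Integration.integral_combine) auto
  thus ?thesis using u bspec[OF G u] bspec[OF G, of d] by (simp add: eq)
qed

text \<open>Writing \<open>min v w - c\<close> as the integral of \<open>indicator {..w}\<close>
  over \<open>[c, v]\<close> lets the triangle swap move the integration of \<open>\<phi>\<close> to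
  a tail, which is \<open>G d - G u\<close>.\<close>

lemma set_integral_min_mult:
  fixes \<phi> G :: "real \<Rightarrow> real"
  assumes \<phi>: "set_integrable lborel {c..d} \<phi>"
    and G: "\<forall>x\<in>{c..d}. G x - G c = (LINT t:{c..x}|lborel. \<phi> t)" and w: "w \<in> {c..d}"
  shows "set_integrable lborel {c..d} (\<lambda>v. min v w * \<phi> v)" (is ?integrable)
    and "(LINT v:{c..d}|lborel. min v w * \<phi> v) =
           c * (G d - G c) + (LINT u:{c..w}|lborel. G d - G u)" (is "?integral = ?rhs")
proof -
  have ind: "set_integrable lborel {c..d} (indicator {..w} :: real \<Rightarrow> real)"
  proof -
    have "integrable lborel (indicator {c..min d w} :: real \<Rightarrow> real)"
      by (intro integrable_real_indicator) (auto simp: emeasure_lborel_Icc_eq)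
    also have "indicator {c..min d w} = (\<lambda>u. indicator {c..d} u *\<^sub>R (indicator {..w} u :: real))"
      by (auto simp: indicator_def)
    finally show ?thesis unfolding set_integrable_def .
  qed
  have min_eq: "min v w * \<phi> v = c * \<phi> v + \<phi> v * (LINT u:{c..v}|lborel. indicator {..w} u)"
    if "v \<in> {c..d}" for v
  proof -
    have "(LINT u:{c..v}|lborel. (indicator {..w} u :: real)) = (LINT u|lborel. indicator {c..min v w} u)"
      unfolding set_lebesgue_integral_def
      by (intro Bochner_Integration.integral_cong) (auto simp: indicator_def)
    also have "\<dots> = min v w - c" using that w by simp
    finally have eq: "(LINT u:{c..v}|lborel. (indicator {..w} u :: real)) = min v w - c" .
    show ?thesis unfolding eq by (simp add: algebra_simps)
  qed
  note tri = set_integrable_triangle[OF \<phi> ind] set_integral_triangle_swap[OF \<phi> ind]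
  have "set_integrable lborel {c..d}
      (\<lambda>v. c * \<phi> v + \<phi> v * (LINT u:{c..v}|lborel. indicator {..w} u))"
    using \<phi> tri(1) by (intro set_integral_add) auto
  also have "?this \<longleftrightarrow> ?integrable"
    by (intro set_integrable_cong) (simp_all add: min_eq)
  finally show ?integrable .
  have "?integral = (LINT v:{c..d}|lborel. c * \<phi> v + \<phi> v * (LINT u:{c..v}|lborel. indicator {..w} u))"
    by (intro set_lebesgue_integral_cong) (auto simp: min_eq)
  also have "\<dots> = c * (LINT v:{c..d}|lborel. \<phi> v) +
      (LINT u:{c..d}|lborel. indicator {..w} u * (LINT v:{u..d}|lborel. \<phi> v))"
    using \<phi> tri by (subst set_integral_add) auto
  also have "(LINT v:{c..d}|lborel. \<phi> v) = G d - G c"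
    using w by (intro set_integral_tail[OF \<phi> G]) auto
  also have "(LINT u:{c..d}|lborel. indicator {..w} u * (LINT v:{u..d}|lborel. \<phi> v)) =
      (LINT u:{c..d}|lborel. indicator {..w} u * (G d - G u))"
    using set_integral_tail[OF \<phi> G] by (intro set_lebesgue_integral_cong) auto
  also have "\<dots> = (LINT u:{c..w}|lborel. G d - G u)"
    using w unfolding set_lebesgue_integral_def
    by (intro Bochner_Integration.integral_cong) (auto simp: indicator_def)
  finally show "?integral = ?rhs" .
qed

text \<open>The case \<open>w = d\<close> of the previous lemma, where \<open>min v d = v\<close>.
  The value is \<open>d * G d - c * G c\<close> minus the integral of \<open>G\<close>; completing
  it with \<open>(1 - d) * G d\<close> is how \<open>Delta\<close> enters.\<close>

lemma set_integral_id_mult: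
  fixes \<phi> G :: "real \<Rightarrow> real"
  assumes \<phi>: "set_integrable lborel {c..d} \<phi>"
    and G: "\<forall>x\<in>{c..d}. G x - G c = (LINT t:{c..x}|lborel. \<phi> t)"
    and cont: "continuous_on {c..d} G" and "c \<le> d"
  shows "set_integrable lborel {c..d} (\<lambda>v. v * \<phi> v)"
    and "(LINT v:{c..d}|lborel. v * \<phi> v) = G d - Delta c (1 - d) G"
proof -
  have d: "d \<in> {c..d}" using \<open>c \<le> d\<close> by simp
  note min = set_integral_min_mult[OF \<phi> G d]
  have "set_integrable lborel {c..d} (\<lambda>v. min v d * \<phi> v) \<longleftrightarrow> set_integrable lborel {c..d} (\<lambda>v. v * \<phi> v)"
    by (intro set_integrable_cong) (auto simp: min_def)
  thus "set_integrable lborel {c..d} (\<lambda>v. v * \<phi> v)" using min(1) by simp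
  have "(LINT v:{c..d}|lborel. v * \<phi> v) = (LINT v:{c..d}|lborel. min v d * \<phi> v)"
    by (intro set_lebesgue_integral_cong) (auto simp: min_def)
  also have "\<dots> = c * (G d - G c) + (LINT u:{c..d}|lborel. G d - G u)" by (rule min(2))
  also have "(LINT u:{c..d}|lborel. G d - G u) = (d - c) * G d - (LINT u:{c..d}|lborel. G u)"
    using borel_integrable_atLeastAtMost'[OF cont] \<open>c \<le> d\<close>
    by (subst set_integral_diff) (auto simp: set_integrable_def set_lebesgue_integral_def)
  also have "(LINT u:{c..d}|lborel. G u) = (LINT u:{c..d}|lebesgue. G u)"
    using borel_integrable_atLeastAtMost'[OF cont]
    unfolding set_lebesgue_integral_def set_integrable_def
    by (intro integral_completion[symmetric]) (rule borel_measurable_integrable)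
  finally show "(LINT v:{c..d}|lborel. v * \<phi> v) = G d - Delta c (1 - d) G"
    by (simp add: Delta_def algebra_simps)
qed

text \<open>The part \<open>v * w\<close> of the kernel factors into two first moments. The part
  \<open>min v w\<close> yields \<open>c * (G d - G c) * (L d - L c)\<close> plus the integral of
  the product of the two tails.\<close>

lemma iterated_integral_covariance_kernel:
  fixes \<phi> \<psi> G L :: "real \<Rightarrow> real"
  assumes \<phi>: "set_integrable lborel {c..d} \<phi>"
    and G: "\<forall>x\<in>{c..d}. G x - G c = (LINT t:{c..x}|lborel. \<phi> t)" "continuous_on {c..d} G"
    and \<psi>: "set_integrable lborel {c..d} \<psi>"
    and L: "\<forall>x\<in>{c..d}. L x - L c = (LINT t:{c..x}|lborel. \<psi> t)" "continuous_on {c..d} L"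
    and "c \<le> d"
  shows "(LINT w:{c..d}|lborel. (LINT v:{c..d}|lborel. K v w * \<phi> v) * \<psi> w) =
           c * G c * L c + (1 - d) * G d * L d + (LINT u:{c..d}|lborel. G u * L u)
           - Delta c (1 - d) G * Delta c (1 - d) L"
proof -
  let ?m = "LINT v:{c..d}|lborel. v * \<phi> v"
  let ?A = "\<lambda>u. G d - G u"
  have intG: "set_integrable lborel {c..d} G" and intL: "set_integrable lborel {c..d} L"
    and intGL: "set_integrable lborel {c..d} (\<lambda>u. G u * L u)"
    using G L by (auto intro!: borel_integrable_atLeastAtMost' continuous_intros)
  have const: "set_integrable lborel {c..d} (\<lambda>u. k :: real)"
      "(LINT u:{c..d}|lborel. k :: real) = (d - c) * k" for k
    using \<open>c \<le> d\<close> by (auto simp: set_integrable_def set_lebesgue_integral_def)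
  have intA: "set_integrable lborel {c..d} ?A" using intG const by (intro set_integral_diff)
  note idG = set_integral_id_mult[OF \<phi> G \<open>c \<le> d\<close>]
  note idL = set_integral_id_mult[OF \<psi> L \<open>c \<le> d\<close>]
  note tri = set_integrable_triangle[OF \<psi> intA] set_integral_triangle_swap[OF \<psi> intA]
  have inner: "(LINT v:{c..d}|lborel. K v w * \<phi> v) * \<psi> w =
      c * (G d - G c) * \<psi> w + \<psi> w * (LINT u:{c..w}|lborel. ?A u) - ?m * (w * \<psi> w)"
    if w: "w \<in> {c..d}" for w
  proof -
    have "(LINT v:{c..d}|lborel. K v w * \<phi> v) = (LINT v:{c..d}|lborel. min v w * \<phi> v - w * (v * \<phi> v))"
      by (simp add: K_def algebra_simps)
    also have "\<dots> = c * (G d - G c) + (LINT u:{c..w}|lborel. ?A u) - w * ?m"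
      using set_integral_min_mult[OF \<phi> G(1) w] idG(1) by (subst set_integral_diff) auto
    finally have eq: "(LINT v:{c..d}|lborel. K v w * \<phi> v) =
        c * (G d - G c) + (LINT u:{c..w}|lborel. ?A u) - w * ?m" .
    show ?thesis unfolding eq by (simp add: algebra_simps)
  qed
  have "(LINT w:{c..d}|lborel. (LINT v:{c..d}|lborel. K v w * \<phi> v) * \<psi> w) =
      (LINT w:{c..d}|lborel. c * (G d - G c) * \<psi> w + \<psi> w * (LINT u:{c..w}|lborel. ?A u) - ?m * (w * \<psi> w))"
    by (intro set_lebesgue_integral_cong) (auto simp: inner)
  also have "\<dots> = (LINT w:{c..d}|lborel. c * (G d - G c) * \<psi> w + \<psi> w * (LINT u:{c..w}|lborel. ?A u))
      - (LINT w:{c..d}|lborel. ?m * (w * \<psi> w))"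
    using \<psi> tri(1) idL(1)
    by (intro set_integral_diff(2) set_integral_add(1) set_integrable_mult_right) auto
  also have "(LINT w:{c..d}|lborel. ?m * (w * \<psi> w)) = ?m * (LINT w:{c..d}|lborel. w * \<psi> w)"
    by (rule set_integral_mult_right)
  also have "(LINT w:{c..d}|lborel. c * (G d - G c) * \<psi> w + \<psi> w * (LINT u:{c..w}|lborel. ?A u)) =
      (LINT w:{c..d}|lborel. c * (G d - G c) * \<psi> w) + (LINT w:{c..d}|lborel. \<psi> w * (LINT u:{c..w}|lborel. ?A u))"
    using \<psi> tri(1) by (intro set_integral_add(2) set_integrable_mult_right) auto
  also have "(LINT w:{c..d}|lborel. c * (G d - G c) * \<psi> w) = c * (G d - G c) * (LINT w:{c..d}|lborel. \<psi> w)"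
    by (rule set_integral_mult_right)
  also have "(LINT w:{c..d}|lborel. \<psi> w) = L d - L c"
    using \<open>c \<le> d\<close> by (intro set_integral_tail[OF \<psi> L(1)]) auto
  \<comment> \<open>A second triangle swap converts the running integral of the tail of
    \<open>G\<close> into a tail of \<open>L\<close>.\<close>
  also have "(LINT w:{c..d}|lborel. \<psi> w * (LINT u:{c..w}|lborel. ?A u)) =
      (LINT u:{c..d}|lborel. ?A u * (LINT w:{u..d}|lborel. \<psi> w))" by (rule tri(2))
  also have "\<dots> = (LINT u:{c..d}|lborel. (G d * L d - L d * G u) - (G d * L u - G u * L u))"
    by (intro set_lebesgue_integral_cong) (auto simp: set_integral_tail[OF \<psi> L(1)] algebra_simps)
  also have "\<dots> = ((d - c) * (G d * L d) - L d * (LINT u:{c..d}|lborel. G u))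
      - (G d * (LINT u:{c..d}|lborel. L u) - (LINT u:{c..d}|lborel. G u * L u))"
    using intG intL intGL const by (simp add: set_integral_diff)
  finally have "(LINT w:{c..d}|lborel. (LINT v:{c..d}|lborel. K v w * \<phi> v) * \<psi> w) =
      c * (G d - G c) * (L d - L c) + ((d - c) * (G d * L d) - L d * (LINT u:{c..d}|lborel. G u)
      - (G d * (LINT u:{c..d}|lborel. L u) - (LINT u:{c..d}|lborel. G u * L u)))
      - (G d - Delta c (1 - d) G) * (L d - Delta c (1 - d) L)"
    unfolding idG(2) idL(2) .
  \<comment> \<open>Once the plain integrals of \<open>G\<close> and \<open>L\<close> are expressed
    through \<open>Delta\<close>, the mixed terms cancel and the coefficient of
    \<open>G d * L d\<close> reduces to \<open>1 - d\<close>.\<close>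
  moreover have "(LINT u:{c..d}|lborel. G u) = Delta c (1 - d) G - c * G c - (1 - d) * G d"
    and "(LINT u:{c..d}|lborel. L u) = Delta c (1 - d) L - c * L c - (1 - d) * L d"
    using intG intL
    by (simp_all add: Delta_def set_lebesgue_integral_def set_integrable_def integral_completion
          borel_measurable_integrable)
  ultimately show ?thesis by (simp add: algebra_simps)
qed

section \<open>Return from densities to derivatives\<close>

lemma set_integral_lebesgue_AE_eq:
  fixes f g :: "real \<Rightarrow> real"
  assumes f: "f \<in> borel_measurable borel" and S: "S \<in> sets borel"
    and eq: "AE x in lebesgue. x \<in> S \<longrightarrow> g x = f x"
  shows "(LINT x:S|lebesgue. g x) = (LINT x:S|lborel. f x)"
proof -
  let ?f = "\<lambda>x. indicator S x *\<^sub>R f x" and ?g = "\<lambda>x. indicator S x *\<^sub>R g x"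
  have AE: "AE x in lebesgue. ?g x = ?f x"
    using eq by eventually_elim (auto simp: indicator_def)
  have f': "?f \<in> borel_measurable lborel" using f S by simp
  hence f'': "?f \<in> borel_measurable lebesgue" by (rule measurable_completion)
  \<comment> \<open>This is where completeness enters: preimages under \<open>?g\<close> and
    \<open>?f\<close> differ by a null set, so those of \<open>?g\<close> are Lebesgue measurable
    too.\<close>
  have "?g \<in> borel_measurable lebesgue"
  proof (rule measurableI)
    fix B :: "real set" assume "B \<in> sets borel"
    hence sets: "?f -` B \<inter> space lebesgue \<in> sets lebesgue" by (rule measurable_sets[OF f''])
    have "AE x in lebesgue. (x \<in> ?f -` B \<inter> space lebesgue) \<longleftrightarrow> (x \<in> ?g -` B \<inter> space lebesgue)"
      using AE by eventually_elim auto
    thus "?g -` B \<inter> space lebesgue \<in> sets lebesgue"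
      by (rule completion.in_sets_AE[OF _ sets]) auto
  qed auto
  hence "integral\<^sup>L lebesgue ?g = integral\<^sup>L lebesgue ?f"
    using AE f'' by (intro integral_cong_AE) auto
  also have "\<dots> = integral\<^sup>L lborel ?f" by (rule integral_completion[OF f'])
  finally show ?thesis by (simp add: set_lebesgue_integral_def)
qed

lemma abs_continuous_imp_continuous:
  assumes "abs_continuous_on_interval c d f" "c \<le> d"
  shows "continuous_on {c..d} f"
proof -
  have "continuous_on {c..d} (\<lambda>x. f (clamp_real c d x))"
    using continuous_clamp_abs_continuous[OF assms] by (rule continuous_on_subset) simp
  thus ?thesis by (rule continuous_on_eq) (simp add: clamp_real_def)
qed

lemma V11_abs_continuous:
  assumes G: "abs_continuous_on_interval a (1 - b) G" and L: "abs_continuous_on_interval a (1 - b) L"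
    and le: "a \<le> 1 - b"
  shows "V11 a b L G = a * L a * G a + b * L (1 - b) * G (1 - b)
           + (LINT v:{a..1 - b}|lebesgue. L v * G v) - Delta a b L * Delta a b G"
proof -
  let ?I = "{a..1 - b}"
  obtain \<phi> where \<phi>: "\<phi> \<in> borel_measurable borel" "set_integrable lborel ?I \<phi>"
    "AE x in lebesgue. x \<in> ?I \<longrightarrow> deriv G x = \<phi> x"
    "\<forall>x\<in>?I. G x - G a = (LINT t:{a..x}|lborel. \<phi> t)"
    by (rule abs_continuous_fundamental_theorem[OF G le])
  obtain \<psi> where \<psi>: "\<psi> \<in> borel_measurable borel" "set_integrable lborel ?I \<psi>"
    "AE x in lebesgue. x \<in> ?I \<longrightarrow> deriv L x = \<psi> x"
    "\<forall>x\<in>?I. L x - L a = (LINT t:{a..x}|lborel. \<psi> t)"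
    by (rule abs_continuous_fundamental_theorem[OF L le])
  note [measurable] = \<phi>(1) \<psi>(1)
  have [measurable]: "(\<lambda>p. K (fst p) (snd p)) \<in> borel_measurable (borel \<Otimes>\<^sub>M borel)"
    unfolding K_def by measurable
  let ?J = "\<lambda>w. LINT v:?I|lborel. K v w * \<phi> v"
  \<comment> \<open>For fixed \<open>w\<close> the value \<open>deriv L w\<close> is a constant
    factor, so the identity holds for every \<open>w\<close> and only \<open>deriv G\<close> is
    replaced at this stage.\<close>
  have inner: "(LINT v:?I|lebesgue. K v w * deriv G v * deriv L w) = ?J w * deriv L w" for w
  proof -
    have "(LINT v:?I|lebesgue. K v w * deriv G v * deriv L w) =
        (LINT v:?I|lborel. K v w * \<phi> v * deriv L w)"
      using \<phi>(3) by (intro set_integral_lebesgue_AE_eq) (auto simp: K_def)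
    thus ?thesis by simp
  qed
  \<comment> \<open>Replacing \<open>deriv L\<close> in the outer integral requires the new
    integrand \<open>?J w * \<psi> w\<close> to be Borel; joint measurability of the kernel supplies
    this.\<close>
  have J[measurable]: "?J \<in> borel_measurable borel"
    unfolding set_lebesgue_integral_def K_def by measurable
  have "V11 a b L G = (LINT w:?I|lborel. ?J w * \<psi> w)"
    unfolding V11_def inner
    using \<psi>(3) by (intro set_integral_lebesgue_AE_eq) auto
  also have "\<dots> = a * G a * L a + (1 - (1 - b)) * G (1 - b) * L (1 - b)
      + (LINT u:?I|lborel. G u * L u) - Delta a (1 - (1 - b)) G * Delta a (1 - (1 - b)) L"
    by (intro iterated_integral_covariance_kernel \<phi> \<psi> abs_continuous_imp_continuous G L le)
  also have "(LINT u:?I|lborel. G u * L u) = (LINT u:?I|lebesgue. L u * G u)"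
  proof -
    have "set_integrable lborel ?I (\<lambda>u. L u * G u)"
      by (intro borel_integrable_atLeastAtMost' continuous_intros abs_continuous_imp_continuous G L le)
    thus ?thesis
      unfolding set_integrable_def set_lebesgue_integral_def
      by (subst integral_completion) (auto simp: borel_measurable_integrable mult.commute)
  qed
  finally show ?thesis by (simp add: mult_ac)
qed

theorem corollary2:
  fixes M :: "real measure" and F :: "real \<Rightarrow> real"
    and k i j :: nat
    and h :: "nat \<Rightarrow> ereal \<Rightarrow> ereal"
    and H :: "nat \<Rightarrow> real \<Rightarrow> real"
    and as bs :: "nat \<Rightarrow> real"
    and a b :: real
  assumes "real_distribution M" and "F = cdf M"
    and "\<And>r x. r \<in> {1..k} \<Longrightarrow> \<bar>h r (ereal x)\<bar> \<noteq> \<infinity>"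
    and "\<And>r. r \<in> {1..k} \<Longrightarrow> H r = H_fun F (h r)"
    and "i \<in> {1..k}" and "j \<in> {1..k}"
    and "a = as i" and "as i = as j"
    and "1 - b = 1 - bs i" and "1 - bs i = 1 - bs j"
    and "0 \<le> a" and "a \<le> 1 - b" and "1 - b \<le> 1"
    and "\<And>r u. r \<in> {i, j} \<Longrightarrow> u \<in> {a..1 - b} \<Longrightarrow> \<bar>h r (quantile F u)\<bar> \<noteq> \<infinity>"
    and "\<And>r. r \<in> {i, j} \<Longrightarrow> abs_continuous_on_interval a (1 - b) (H r)"
  shows "V11 a b (H i) (H j) =
           a * H i a * H j a + b * H i (1 - b) * H j (1 - b)
           + (LINT v:{a..1 - b}|lebesgue. H i v * H j v)
           - Delta a b (H i) * Delta a b (H j)"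
proof -
  have "abs_continuous_on_interval a (1 - b) (H i)" "abs_continuous_on_interval a (1 - b) (H j)"
    using assms(15) by blast+
  thus ?thesis using \<open>a \<le> 1 - b\<close> by (intro V11_abs_continuous)
qed

end
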